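(* Let $R$ be a finite commutative ring with $1\neq 0$. Then the total graph $\tau(R)$ is Eulerian if and only if $R$ is isomorphic to a direct sum of two or more finite fields of even orders, i.e., $R\cong \bigoplus_{i=1}^{k}\mathbb{F}_{2^{t_i}}$ for some $k\ge 2$ and positive integers $t_1,\ldots,t_k$.
   Context: $Z(R)$ denotes the set of zero-divisors of $R$, with $0$ included in $Z(R)$. The total graph $\tau(R)$ is the simple graph whose vertices are all elements of $R$, in which two distinct vertices $x,y$ are adjacent if and only if $x+y\in Z(R)$. A graph is Eulerian if it is connected and has a closed trail containing all its edges; equivalently, it is connected and all its vertex degrees are even. $\mathbb{F}_q$ denotes the finite field with $q$ elements. *)

theory Defs
  imports "HOL-Algebra.Algebra" "Graph_Theory.Graph_Theory"
begin

text \<open>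
  One-sided, hence meant for commutative rings only. The zero of the ring counts as a zero-divisor.
\<close>
definition zero_divisors :: "('a, 'm) ring_scheme \<Rightarrow> 'a set" where
  "zero_divisors R =
     insert \<zero>\<^bsub>R\<^esub> {x \<in> carrier R. \<exists>y \<in> carrier R. y \<noteq> \<zero>\<^bsub>R\<^esub> \<and> x \<otimes>\<^bsub>R\<^esub> y = \<zero>\<^bsub>R\<^esub>}"

text \<open>
  As usual in \<^theory>\<open>Graph_Theory.Graph_Theory\<close>, a simple graph is a symmetric loop-free digraph:
  an edge \<open>{x, y}\<close> is represented by the two arcs \<open>(x, y)\<close> and \<open>(y, x)\<close>.
\<close>
definition total_graph :: "('a, 'm) ring_scheme \<Rightarrow> 'a pair_pre_digraph" where
  "total_graph R =
     \<lparr> pverts = carrier R,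
       parcs = {(x, y). x \<in> carrier R \<and> y \<in> carrier R \<and> x \<noteq> y \<and> x \<oplus>\<^bsub>R\<^esub> y \<in> zero_divisors R} \<rparr>"

definition uedge :: "'a \<times> 'a \<Rightarrow> 'a set" where
  "uedge e = {fst e, snd e}"

text \<open>
  A trail of an undirected graph may use each edge only once, in one of its two directions.
  So \<open>pre_digraph.trail\<close>, which only asks the arcs to be distinct and would allow both
  \<open>(x, y)\<close> and \<open>(y, x)\<close>, is not the right notion here; distinctness and coverage are required of
  the underlying undirected edges.
\<close>
definition closed_utrail :: "'a pair_pre_digraph \<Rightarrow> ('a \<times> 'a) list \<Rightarrow> bool" where
  "closed_utrail G p \<longleftrightarrow>
     (\<exists>u. pre_digraph.awalk (with_proj G) u p u) \<and> distinct (map uedge p)"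

definition eulerian :: "'a pair_pre_digraph \<Rightarrow> bool" where
  "eulerian G \<longleftrightarrow>
     Digraph_Component.connected (with_proj G) \<and>
     (\<exists>p. closed_utrail G p \<and> uedge ` parcs G \<subseteq> uedge ` set p)"

definition finite_field_of_order :: "nat \<Rightarrow> ('a, 'm) ring_scheme \<Rightarrow> bool" where
  "finite_field_of_order q F \<longleftrightarrow> field F \<and> finite (carrier F) \<and> order F = q"

end

theory Submission
  imports Defs
begin

text \<open>
  Let \<open>Z\<close> be the set of zero-divisors. Both sides of the equivalence are shown to say the same
  about the finite ring \<open>R\<close>: it has characteristic two, it is reduced, and it is not a field
  (\<open>eulerian_total_graph_iff\<close>, \<open>iso_product_of_even_fields_iff\<close>).

  The parity of the degrees is what forces the first two properties. Translation by \<open>x\<close> maps the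
  neighbours of \<open>x\<close> onto \<open>Z\<close> with \<open>x + x\<close> removed. For \<open>x = 0\<close> an even degree therefore means that
  \<open>\<bar>Z\<bar>\<close> is odd, and for \<open>x = 1\<close> it then means that \<open>1 + 1\<close> lies in \<open>Z\<close>. So some \<open>y \<noteq> 0\<close>
  satisfies \<open>y + y = 0\<close>, translation by \<open>y\<close> pairs off the elements of \<open>R\<close>, and \<open>\<bar>R\<bar>\<close> is even. In a
  finite ring every element that is not a zero-divisor is a unit, so the number of units is odd. But
  multiplication by a unit of order two would pair off the units. Hence \<open>-1 = 1\<close>, and if \<open>x\<^sup>2 = 0\<close>
  then \<open>(1 + x)\<^sup>2 = 1\<close>, so that \<open>x = 0\<close>. Conversely, in a reduced ring of characteristic two
  the inversion of units fixes only \<open>1\<close>, so the number of units is odd and all degrees are even.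

  Connectedness excludes fields, where \<open>0\<close> is isolated. If \<open>R\<close> is reduced and not a field, then it has
  two distinct maximal ideals \<open>M\<close> and \<open>N\<close>; every \<open>x\<close> is \<open>m + n\<close> with \<open>m \<in> M\<close> and \<open>n \<in> N\<close>, and in
  characteristic two \<open>0, m, x\<close> is a path in the graph, because \<open>m + x = n\<close>.

  That connectedness and even degrees suffice for a closed Euler trail is proved with a trail of
  maximal length (\<open>eulerianI_even_degree\<close>). That a finite reduced ring is a product of fields is the
  Chinese remainder theorem for all its maximal ideals, whose intersection is zero
  (\<open>reduced_Inter_maximal\<close>). The factors have characteristic two, so their orders are powers of two.
\<close>

text \<open>
  Below, \<open>\<oplus>\<close> and \<open><+>\<close> are always the sum in a ring and the sum of ideals; they must not be read as
  the join of vertex walks and the disjoint union of sets.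
\<close>
no_notation Sum_Type.Plus (infixr \<open><+>\<close> 65)
no_notation vwalk_join (infixr \<open>\<oplus>\<close> 65)

section \<open>Involutions without fixed points\<close>

text \<open>
  The orbits of such an involution are pairs. All parity arguments about groups and rings below
  are instances of this.
\<close>
lemma even_card_involution:
  assumes "finite A" "\<And>x. x \<in> A \<Longrightarrow> f x \<in> A" "\<And>x. x \<in> A \<Longrightarrow> f (f x) = x"
    "\<And>x. x \<in> A \<Longrightarrow> f x \<noteq> x"
  shows "even (card A)"
proof -
  let ?C = "(\<lambda>x. {x, f x}) ` A"
  have U: "\<Union>?C = A" using assms(2) by auto
  have "2 * card ?C = card (\<Union>?C)"
  proof (rule card_partition)
    show "finite ?C" "finite (\<Union>?C)" using assms(1) U by auto
    show "card c = 2" if "c \<in> ?C" for c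
      using that assms(4) by (auto simp: card_2_iff)
    have orbit: "{z, f z} = {x, f x}" if "x \<in> A" "z \<in> {x, f x}" for x z
      using that assms(3) by auto
    show "c1 \<inter> c2 = {}" if "c1 \<in> ?C" "c2 \<in> ?C" "c1 \<noteq> c2" for c1 c2
      using that orbit by blast
  qed
  then show ?thesis unfolding U by (metis dvd_triv_left)
qed

text \<open>
  An odd prime divisor \<open>p\<close> of the order would give a subgroup of order \<open>p\<close>, and translation by one of
  its non-trivial elements would be an involution of that subgroup.
\<close>
lemma order_two_power_if_involutive:
  fixes G (structure)
  assumes "group G" "finite (carrier G)" and inv: "\<And>x. x \<in> carrier G \<Longrightarrow> x \<otimes> x = \<one>"
  shows "\<exists>t. order G = 2 ^ t"
proof -
  interpret group G by fact
  have pos: "order G \<noteq> 0" using assms(2) by (simp add: order_gt_0_iff_finite)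
  then obtain m where m: "order G = 2 ^ multiplicity 2 (order G) * m" "\<not> 2 dvd m"
    using multiplicity_decompose'[of "order G" 2] by auto
  have "m = 1"
  proof (rule ccontr)
    assume "m \<noteq> 1"
    then obtain p where p: "Factorial_Ring.prime p" "p dvd m" using prime_factor_nat by blast
    then have "p dvd order G" using m(1) by (metis dvd_mult)
    then obtain k where "order G = p ^ 1 * k" by auto
    \<comment> \<open>The first power of \<open>p\<close> is enough: this is Cauchy's theorem.\<close>
    from sylow_thm[OF p(1) assms(1) this assms(2)] obtain H where
      H: "subgroup H G" "card H = p" by auto
    interpret H: subgroup H G by fact
    have "p > 1" using p(1) prime_gt_1_nat by blast
    then have "H \<noteq> {\<one>}" using H(2) by auto
    then obtain h where h: "h \<in> H" "h \<noteq> \<one>" using H.one_closed by blast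
    have hG: "h \<in> carrier G" using h(1) H.subset by auto
    have "even (card H)"
    proof (rule even_card_involution[where f = "\<lambda>x. x \<otimes> h"])
      show "finite H" using assms(2) H.subset finite_subset by blast
    next
      fix x assume x: "x \<in> H"
      then have xG: "x \<in> carrier G" using H.subset by auto
      show "x \<otimes> h \<in> H" using x h(1) by simp
      show "x \<otimes> h \<otimes> h = x" using xG hG inv[OF hG] by (simp add: m_assoc)
      show "x \<otimes> h \<noteq> x" using xG hG h(2) by (simp add: r_cancel_one)
    qed
    then have "p = 2" using p(1) H(2) by (metis primes_dvd_imp_eq two_is_prime_nat)
    then show False using p(2) m(2) by simp
  qed
  then show ?thesis using m(1) by auto
qed

text \<open>
  If \<open>1 + 1 \<noteq> 0\<close>, then negation pairs off the non-zero elements, and the order is odd.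
\<close>
lemma double_zero_if_even_order:
  fixes F (structure)
  assumes "field F" "finite (carrier F)" "even (order F)" "x \<in> carrier F"
  shows "x \<oplus> x = \<zero>"
proof (rule ccontr)
  interpret field F by fact
  have double: "r \<oplus> r = (\<one> \<oplus> \<one>) \<otimes> r" if "r \<in> carrier F" for r
    using that by (simp add: l_distr)
  assume "x \<oplus> x \<noteq> \<zero>"
  then have two: "\<one> \<oplus> \<one> \<noteq> \<zero>" using double[OF assms(4)] assms(4) by auto
  have "even (card (carrier F - {\<zero>}))"
  proof (rule even_card_involution[where f = "\<lambda>r. \<ominus> r"])
    fix r assume "r \<in> carrier F - {\<zero>}"
    then have r: "r \<in> carrier F" "r \<noteq> \<zero>" by auto
    show inv: "\<ominus> (\<ominus> r) = r" using r by simp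
    have "\<ominus> r \<noteq> \<zero>" using inv r(2) minus_zero by metis
    then show "\<ominus> r \<in> carrier F - {\<zero>}" using r(1) by simp
    show "\<ominus> r \<noteq> r"
    proof
      assume "\<ominus> r = r"
      then have "r \<oplus> r = \<zero>" using r_neg[OF r(1)] by simp
      then have "(\<one> \<oplus> \<one>) \<otimes> r = \<zero>" using double[OF r(1)] by simp
      then show False using integral[of "\<one> \<oplus> \<one>" r] two r by simp
    qed
  qed (use assms(2) in simp)
  moreover have "order F = Suc (card (carrier F - {\<zero>}))"
    unfolding order_def by (rule card.remove[OF assms(2) zero_closed])
  ultimately show False using assms(3) by simp
qed

section \<open>Closed Euler trails\<close>

text \<open>
  Walking along a trail enters and leaves each vertex equally often, except at its two ends.
\<close>
lemma odd_trail_edges_at_iff: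
  assumes "pcas u p w" "distinct (map uedge p)" "\<And>e. e \<in> set p \<Longrightarrow> fst e \<noteq> snd e"
  shows "odd (card {E \<in> uedge ` set p. v \<in> E}) \<longleftrightarrow> (v = u) \<noteq> (v = w)"
  using assms
proof (induction p arbitrary: u)
  case Nil
  then show ?case by simp
next
  case (Cons e p)
  let ?N = "\<lambda>p. {E \<in> uedge ` set p. v \<in> E}"
  have IH: "odd (card (?N p)) \<longleftrightarrow> (v = snd e) \<noteq> (v = w)"
    using Cons by auto
  have new: "uedge e \<notin> ?N p" and e: "fst e = u" "u \<noteq> snd e"
    using Cons.prems by auto
  have "?N (e # p) = (if v \<in> uedge e then insert (uedge e) (?N p) else ?N p)"
    by auto
  then have "card (?N (e # p)) = card (?N p) + (if v \<in> uedge e then 1 else 0)"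
    using card_insert_disjoint[OF _ new] by simp
  moreover have "v \<in> uedge e \<longleftrightarrow> v = u \<or> v = snd e" using e by (auto simp: uedge_def)
  ultimately show ?case using IH e by auto
qed

context pair_graph
begin

lemma card_edges_at:
  "card {E \<in> uedge ` parcs G. v \<in> E} = card {y. (v, y) \<in> parcs G}"
proof -
  have "{E \<in> uedge ` parcs G. v \<in> E} = (\<lambda>y. {v, y}) ` {y. (v, y) \<in> parcs G}"
    by (auto simp: uedge_def image_iff Bex_def doubleton_eq_iff intro: arcs_symmetric)
  moreover have "inj_on (\<lambda>y. {v, y}) {y. (v, y) \<in> parcs G}"
    by (auto simp: inj_on_def doubleton_eq_iff)
  ultimately show ?thesis by (simp add: card_image)
qed

lemma eulerian_imp_even_degree:
  assumes "eulerian G"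
  shows "even (card {y. (v, y) \<in> parcs G})"
proof -
  obtain p u where p: "awalk u p u" "distinct (map uedge p)"
      "uedge ` parcs G \<subseteq> uedge ` set p"
    using assms unfolding eulerian_def closed_utrail_def by blast
  have sub: "set p \<subseteq> parcs G" using p(1) by (auto simp: awalk_def)
  have "uedge ` set p = uedge ` parcs G" using p(3) sub by blast
  moreover have "even (card {E \<in> uedge ` set p. v \<in> E})"
    using odd_trail_edges_at_iff[of u p u v] p(1,2) sub no_loops by (auto simp: awalk_def)
  ultimately show ?thesis using card_edges_at by simp
qed

text \<open>
  Euler's theorem. A longest trail uses every edge at its last vertex. As the degree of that vertex is
  even, the trail is closed. It can then be rotated to end at any vertex it visits and so uses every
  edge at each of them; by connectedness it visits all vertices.
\<close>
lemma eulerianI_even_degree: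
  assumes conn: "Digraph_Component.connected G"
    and even: "\<And>v. v \<in> pverts G \<Longrightarrow> even (card {y. (v, y) \<in> parcs G})"
  shows "eulerian G"
proof -
  define T where "T p \<longleftrightarrow> (\<exists>u w. awalk u p w) \<and> distinct (map uedge p)" for p
  have sc: "strongly_connected G"
    using symmetric_connected_imp_strongly_connected[OF sym_arcs conn] .
  then obtain v0 where v0: "v0 \<in> pverts G" by (auto simp: strongly_connected_def)
  then have "T []" by (auto simp: T_def awalk_Nil_iff)
  moreover have "length p < Suc (card (uedge ` parcs G))" if "T p" for p
  proof -
    have "length p = card (uedge ` set p)"
      using that distinct_card[of "map uedge p"] by (simp add: T_def)
    also have "\<dots> \<le> card (uedge ` parcs G)"
      using that by (intro card_mono) (auto simp: T_def awalk_def)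
    finally show ?thesis by simp
  qed
  ultimately obtain p where p: "T p" and longest: "\<And>q. T q \<Longrightarrow> length q \<le> length p"
    using ex_has_greatest_nat[of T "[]" length] by metis
  \<comment> \<open>Stated for all trails of maximal length, as it is also applied to the rotations of \<open>p\<close>.\<close>
  have stuck: "uedge (x, y) \<in> uedge ` set q"
    if q: "awalk v q x" "distinct (map uedge q)" "length q = length p" and xy: "(x, y) \<in> parcs G"
    for v q x y
  proof (rule ccontr)
    assume new: "\<not> ?thesis"
    have "awalk v (q @ [(x, y)]) y"
    proof (rule awalk_appendI[OF q(1)])
      show "awalk x [(x, y)] y" using arc_implies_awalk[OF xy] by simp
    qed
    then have "T (q @ [(x, y)])" using new q(2) unfolding T_def by auto
    from longest[OF this] q(3) show False by simp
  qed
  obtain u w where uw: "awalk u p w" "distinct (map uedge p)" using p by (auto simp: T_def)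
  have sub: "set p \<subseteq> parcs G" using uw(1) by (auto simp: awalk_def)
  have w: "w \<in> pverts G" using uw(1) by (rule awalk_last_in_verts)
  have "{E \<in> uedge ` set p. w \<in> E} = {E \<in> uedge ` parcs G. w \<in> E}"
  proof -
    have "E \<in> uedge ` set p" if E: "E \<in> uedge ` parcs G" "w \<in> E" for E
    proof -
      obtain a b where "(a, b) \<in> parcs G" "E = {a, b}" "w = a \<or> w = b"
        using E by (auto simp: uedge_def)
      then obtain y where "(w, y) \<in> parcs G" "E = uedge (w, y)"
        using arcs_symmetric by (auto simp: uedge_def)
      then show ?thesis using stuck[OF uw refl] by simp
    qed
    then show ?thesis using sub by auto
  qed
  then have "even (card {E \<in> uedge ` set p. w \<in> E})"
    using even[OF w] card_edges_at by simp
  moreover have "odd (card {E \<in> uedge ` set p. w \<in> E}) \<longleftrightarrow> (w = u) \<noteq> (w = w)"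
    using uw sub no_loops by (intro odd_trail_edges_at_iff) (auto simp: awalk_def)
  ultimately have closed: "w = u" by simp
  let ?V = "set (pawalk_verts u p)"
  have visited: "uedge (x, y) \<in> uedge ` set p" if x: "x \<in> ?V" and xy: "(x, y) \<in> parcs G" for x y
  proof -
    obtain q r where qr: "p = q @ r" "awalk u q x" "awalk x r u"
      using awalk_decomp[OF uw(1) x] closed by blast
    have "awalk x (r @ q) x" using qr(2,3) by (rule awalk_appendI[rotated])
    moreover have "distinct (map uedge (r @ q))" using uw(2) qr(1) by auto
    moreover have "length (r @ q) = length p" using qr(1) by simp
    ultimately have "uedge (x, y) \<in> uedge ` set (r @ q)" using xy by (rule stuck)
    then show ?thesis using qr(1) by auto
  qed
  have all: "x \<in> ?V" if "x \<in> pverts G" for x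
  proof -
    have "u \<rightarrow>\<^sup>*\<^bsub>G\<^esub> x"
      using sc that awalk_hd_in_verts[OF uw(1)] by (auto simp: strongly_connected_def)
    then show ?thesis
    proof (induction rule: reachable_induct)
      case base
      then show ?case by (metis hd_in_awalk_verts(1)[OF uw(1)])
    next
      case (step x y)
      then have "uedge (x, y) \<in> uedge ` set p" using visited by auto
      then obtain e where "e \<in> set p" "y = fst e \<or> y = snd e"
        by (auto simp: uedge_def doubleton_eq_iff)
      then show ?case
        using set_awalk_verts[OF uw(1)] by auto
    qed
  qed
  have "uedge ` parcs G \<subseteq> uedge ` set p"
  proof
    fix E assume "E \<in> uedge ` parcs G"
    then obtain x y where "(x, y) \<in> parcs G" "E = uedge (x, y)" by auto
    then show "E \<in> uedge ` set p" using visited all in_arcsD1 by blast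
  qed
  then show ?thesis
    using conn uw closed unfolding eulerian_def closed_utrail_def by blast
qed

end

section \<open>Finite reduced rings and their maximal ideals\<close>

definition reduced_ring :: "('a, 'm) ring_scheme \<Rightarrow> bool" where
  "reduced_ring R \<longleftrightarrow> (\<forall>x\<in>carrier R. x \<otimes>\<^bsub>R\<^esub> x = \<zero>\<^bsub>R\<^esub> \<longrightarrow> x = \<zero>\<^bsub>R\<^esub>)"

lemma reduced_ringD:
  "reduced_ring R \<Longrightarrow> x \<in> carrier R \<Longrightarrow> x \<otimes>\<^bsub>R\<^esub> x = \<zero>\<^bsub>R\<^esub> \<Longrightarrow> x = \<zero>\<^bsub>R\<^esub>"
  by (simp only: reduced_ring_def)

lemma reduced_if_domain:
  assumes "domain S"
  shows "reduced_ring S"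
  unfolding reduced_ring_def using domain.integral[OF assms] by metis

context cring
begin

lemma ideal_subset: "ideal J R \<Longrightarrow> J \<subseteq> carrier R"
  using ideal.Icarr[of J R] by auto

text \<open>
  The sum is an ideal above both, so if it were proper, maximality would make it equal to both.
\<close>
lemma comaximal_of_distinct_maximal:
  assumes "maximalideal I R" "maximalideal J R" "I \<noteq> J"
  shows "I <+> J = carrier R"
proof -
  interpret I: maximalideal I R by fact
  interpret J: maximalideal J R by fact
  have id: "ideal (I <+> J) R" using add_ideals[OF I.is_ideal J.is_ideal] .
  have "I \<union> J \<subseteq> I <+> J"
    using genideal_self[of "I \<union> J"] union_genideal[OF I.is_ideal J.is_ideal]
      ideal_subset[OF I.is_ideal] ideal_subset[OF J.is_ideal] by simp
  then have I: "I \<subseteq> I <+> J" and J: "J \<subseteq> I <+> J" by simp_all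
  note sub = ideal_subset[OF id]
  have "I <+> J = I \<or> I <+> J = carrier R" using I.I_maximal[OF id I sub] .
  moreover have "I <+> J = J \<or> I <+> J = carrier R" using J.I_maximal[OF id J sub] .
  ultimately show ?thesis using assms(3) by blast
qed

text \<open>
  Finiteness replaces Zorn's lemma: among the finitely many proper ideals containing \<open>a\<close>, one of
  which is the principal ideal of \<open>a\<close>, there is a maximal one.
\<close>
lemma nonunit_in_maximal:
  assumes "finite (carrier R)" "a \<in> carrier R" "a \<notin> Units R"
  shows "\<exists>M. maximalideal M R \<and> a \<in> M"
proof -
  let ?P = "{J. ideal J R \<and> a \<in> J \<and> J \<noteq> carrier R}"
  have "?P \<subseteq> Pow (carrier R)" using ideal_subset by auto
  then have fin: "finite ?P" using assms(1) finite_subset by blast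
  have "\<one> \<notin> PIdl a"
  proof
    assume "\<one> \<in> PIdl a"
    then obtain x where "x \<in> carrier R" "\<one> = x \<otimes> a" by (auto simp: cgenideal_def)
    then show False using assms(2,3) m_comm by (auto simp: Units_def)
  qed
  then have "PIdl a \<in> ?P" using cgenideal_ideal[OF assms(2)] cgenideal_self[OF assms(2)] by auto
  from finite_has_maximal2[OF fin this]
  obtain M where M: "M \<in> ?P" and max: "\<forall>J\<in>?P. M \<subseteq> J \<longrightarrow> M = J" by (elim bexE conjE)
  have "maximalideal M R"
  proof (rule maximalidealI)
    show "ideal M R" "carrier R \<noteq> M" using M by auto
    show "J = M \<or> J = carrier R" if "ideal J R" "M \<subseteq> J" for J
      using M max that by auto
  qed
  then show ?thesis using M by auto
qed

lemma reduced_pow_eq_zero: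
  assumes "reduced_ring R" "x \<in> carrier R" "x [^] (n::nat) = \<zero>" "\<one> \<noteq> \<zero>"
  shows "x = \<zero>"
  using assms(3)
proof (induction n rule: less_induct)
  case (less n)
  consider "n = 0" | "n = 1" | "n \<ge> 2" by linarith
  then show ?case
  proof cases
    case 3
    \<comment> \<open>The exponent \<open>2 (n - 1)\<close> is at least \<open>n\<close>.\<close>
    have "x [^] (n - 1) \<otimes> x [^] (n - 1) = x [^] n \<otimes> x [^] (n - 2)"
      using 3 assms(2) by (simp add: nat_pow_mult flip: numeral_2_eq_2)
    also have "\<dots> = \<zero>" using less.prems assms(2) by simp
    finally have "x [^] (n - 1) = \<zero>" by (rule reduced_ringD[OF assms(1) nat_pow_closed[OF assms(2)]])
    then show ?thesis using less.IH[of "n - 1"] 3 by simp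
  qed (use less assms in auto)
qed

text \<open>
  By finiteness \<open>a\<^sup>m (1 - a\<^sup>d) = 0\<close> for some \<open>d > 0\<close>. If \<open>a\<close> is in every maximal ideal, then
  \<open>1 - a\<^sup>d\<close> is in none and is a unit. So \<open>a\<close> is nilpotent.
\<close>
lemma reduced_Inter_maximal:
  assumes "finite (carrier R)" "reduced_ring R" "\<one> \<noteq> \<zero>" "a \<in> carrier R"
    and "\<And>M. maximalideal M R \<Longrightarrow> a \<in> M"
  shows "a = \<zero>"
proof -
  have "\<not> inj (\<lambda>n::nat. a [^] n)"
  proof
    assume "inj (\<lambda>n::nat. a [^] n)"
    then have "infinite (range (\<lambda>n::nat. a [^] n))" by (simp add: finite_image_iff)
    then show False using assms(1,4) by (meson finite_subset image_subsetI nat_pow_closed)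
  qed
  then obtain m n :: nat where "m < n" "a [^] m = a [^] n"
    by (auto simp: inj_def) (metis linorder_neqE_nat)
  then obtain d :: nat where d: "d > 0" "a [^] m = a [^] m \<otimes> a [^] d"
  proof -
    assume mn: "m < n" "a [^] m = a [^] n"
    have "a [^] n = a [^] m \<otimes> a [^] (n - m)" using mn(1) assms(4) by (simp add: nat_pow_mult)
    then show thesis using mn by (intro that[of "n - m"]) simp_all
  qed
  have unit: "\<one> \<ominus> a [^] d \<in> Units R"
  proof (rule ccontr)
    assume "\<one> \<ominus> a [^] d \<notin> Units R"
    then obtain M where M: "maximalideal M R" "\<one> \<ominus> a [^] d \<in> M"
      using nonunit_in_maximal[OF assms(1), of "\<one> \<ominus> a [^] d"] assms(4) by auto
    interpret M: maximalideal M R by fact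
    have "a [^] d = a \<otimes> a [^] (d - 1)"
      using d(1) assms(4) nat_pow_mult[of a 1 "d - 1"] by simp
    then have "a [^] d \<in> M" using assms(4,5) M(1) by (simp add: M.I_r_closed)
    then have "(\<one> \<ominus> a [^] d) \<oplus> a [^] d \<in> M" using M(2) by simp
    moreover have "(\<one> \<ominus> c) \<oplus> c = \<one>" if "c \<in> carrier R" for c using that by algebra
    ultimately have "\<one> \<in> M" using assms(4) by simp
    then show False using M.one_imp_carrier M.I_notcarr by auto
  qed
  have "b \<otimes> (\<one> \<ominus> c) = b \<ominus> b \<otimes> c" if "b \<in> carrier R" "c \<in> carrier R" for b c
    using that by algebra
  then have "a [^] m \<otimes> (\<one> \<ominus> a [^] d) = a [^] m \<ominus> a [^] m \<otimes> a [^] d"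
    using assms(4) by simp
  also have "\<dots> = \<zero>" using d(2)[symmetric] assms(4) by simp
  finally have "(\<one> \<ominus> a [^] d) \<otimes> a [^] m = (\<one> \<ominus> a [^] d) \<otimes> \<zero>"
    using assms(4) by (simp add: m_comm)
  then have "a [^] m = \<zero>"
    by (rule iffD1[OF Units_l_cancel[OF unit nat_pow_closed[OF assms(4)] zero_closed]])
  then show ?thesis using reduced_pow_eq_zero assms(2-4) by blast
qed

text \<open>
  If there is only one factor, then the only maximal ideal is zero, which is the last part of the
  conclusion.
\<close>
lemma reduced_iso_residue_fields:
  assumes "finite (carrier R)" "reduced_ring R" "\<one> \<noteq> \<zero>"
  obtains I n where "\<And>i. i \<le> (n::nat) \<Longrightarrow> maximalideal (I i) R"
    "R \<simeq> RDirProd_list (map (\<lambda>i. R Quot (I i)) [0..<Suc n])" "n = 0 \<Longrightarrow> field R"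
proof -
  let ?M = "{M. maximalideal M R}"
  have "?M \<subseteq> Pow (carrier R)" using ideal_subset maximalideal.axioms(1) by auto
  then have "finite ?M" using assms(1) finite_subset by blast
  then obtain I where I: "bij_betw I {0..<card ?M} ?M" using ex_bij_betw_nat_finite by blast
  have "\<zero> \<notin> Units R" using assms(3) by (auto simp: Units_def)
  then have "?M \<noteq> {}" using nonunit_in_maximal[OF assms(1) zero_closed] by blast
  then obtain n where n: "card ?M = Suc n" using \<open>finite ?M\<close> by (metis card_eq_0_iff not0_implies_Suc)
  have IM: "I ` {..n} = ?M" and inj: "inj_on I {..n}"
    using I n by (auto simp: bij_betw_def atLeast0LessThan lessThan_Suc_atMost)
  have max: "maximalideal (I i) R" if "i \<le> n" for i using IM that by auto
  have "(\<Inter>i\<le>n. I i) = {\<zero>}"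
  proof
    show "(\<Inter>i\<le>n. I i) \<subseteq> {\<zero>}"
    proof
      fix a assume a: "a \<in> (\<Inter>i\<le>n. I i)"
      then have "a \<in> carrier R" using ideal_subset[OF maximalideal.axioms(1)[OF max[of 0]]] by auto
      moreover have "a \<in> M" if "maximalideal M R" for M
        using that a IM by (metis INT_iff image_iff mem_Collect_eq)
      ultimately show "a \<in> {\<zero>}" using reduced_Inter_maximal[OF assms] by simp
    qed
    show "{\<zero>} \<subseteq> (\<Inter>i\<le>n. I i)"
      using additive_subgroup.zero_closed[OF ideal.axioms(1)[OF maximalideal.axioms(1)[OF max]]]
      by simp
  qed
  note zero = this
  have "R Quot (\<Inter>i\<le>n. I i) \<simeq> RDirProd_list (map (\<lambda>i. R Quot (I i)) [0..<Suc n])"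
  proof (rule chinese_remainder)
    show "ideal (I i) R" if "i \<le> n" for i using max[OF that] by (rule maximalideal.axioms(1))
    show "I i <+> I j = carrier R" if "i \<le> n" "j \<le> n" "i \<noteq> j" for i j
      using that max inj by (intro comaximal_of_distinct_maximal) (auto simp: inj_on_def)
  qed
  then have iso: "R \<simeq> RDirProd_list (map (\<lambda>i. R Quot (I i)) [0..<Suc n])"
    using FactRing_zeroideal(2) zero ring_iso_trans by metis
  have "field R" if "n = 0"
    using max[of 0] zero that zeromaximalideal_fieldI by simp
  with max iso show thesis using that by blast
qed

end

section \<open>Units and zero-divisors of a finite ring\<close>

context cring
begin

text \<open>
  The one-element ring is excluded because its only element \<open>0\<close> counts as a zero-divisor without
  being annihilated by a non-zero element.
\<close>
lemma zero_divisors_iff: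
  assumes "\<one> \<noteq> \<zero>"
  shows "x \<in> zero_divisors R \<longleftrightarrow> x \<in> carrier R \<and> (\<exists>y\<in>carrier R. y \<noteq> \<zero> \<and> x \<otimes> y = \<zero>)"
proof (cases "x = \<zero>")
  case True
  moreover have "\<zero> \<otimes> \<one> = \<zero>" by simp
  ultimately show ?thesis using assms by (auto simp: zero_divisors_def intro!: bexI[of _ \<one>])
qed (simp add: zero_divisors_def)

text \<open>
  Multiplication by a non-unit is not onto, so by finiteness it is not injective.
\<close>
lemma zero_divisors_finite:
  assumes "finite (carrier R)" "\<one> \<noteq> \<zero>"
  shows "zero_divisors R = carrier R - Units R"
proof
  show "zero_divisors R \<subseteq> carrier R - Units R"
  proof
    fix x assume "x \<in> zero_divisors R"
    then obtain y where x: "x \<in> carrier R" and y: "y \<in> carrier R" "y \<noteq> \<zero>" "x \<otimes> y = \<zero>"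
      using zero_divisors_iff[OF assms(2)] by blast
    have "x \<notin> Units R"
    proof
      assume "x \<in> Units R"
      moreover have "x \<otimes> y = x \<otimes> \<zero>" using x y(3) by simp
      ultimately show False using Units_l_cancel[of x y \<zero>] y(1,2) zero_closed by blast
    qed
    then show "x \<in> carrier R - Units R" using x by simp
  qed
  show "carrier R - Units R \<subseteq> zero_divisors R"
  proof
    fix x assume x: "x \<in> carrier R - Units R"
    have "\<one> \<notin> (\<otimes>) x ` carrier R" using x m_comm by (auto simp: Units_def)
    then have "(\<otimes>) x ` carrier R \<noteq> carrier R" by auto
    moreover have "(\<otimes>) x ` carrier R \<subseteq> carrier R" using x by auto
    ultimately have "\<not> inj_on ((\<otimes>) x) (carrier R)"
      using assms(1) endo_inj_surj by blast
    then obtain y z where yz: "y \<in> carrier R" "z \<in> carrier R" "x \<otimes> y = x \<otimes> z" "y \<noteq> z"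
      by (auto simp: inj_on_def)
    have "x \<otimes> (y \<ominus> z) = x \<otimes> y \<ominus> x \<otimes> z" using x yz(1,2)
      by (simp add: a_minus_def r_distr r_minus)
    then have "x \<otimes> (y \<ominus> z) = \<zero>" using x yz by simp
    moreover have "y \<ominus> z \<noteq> \<zero>" using yz by simp
    ultimately show "x \<in> zero_divisors R" using x yz(1,2) zero_divisors_iff[OF assms(2)] minus_closed by blast
  qed
qed

lemma card_carrier_eq:
  assumes "finite (carrier R)" "\<one> \<noteq> \<zero>"
  shows "card (carrier R) = card (zero_divisors R) + card (Units R)"
proof -
  have "Units R \<subseteq> carrier R" by auto
  then show ?thesis
    using zero_divisors_finite[OF assms] card_Diff_subset[of "Units R" "carrier R"]
      card_mono[of "carrier R" "Units R"] finite_subset[of "Units R"] assms(1) by simp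
qed

lemma finite_Units: "finite (carrier R) \<Longrightarrow> finite (Units R)"
  by (rule finite_subset[of _ "carrier R"]) auto

text \<open>
  Inversion of units fixes only \<open>1\<close>: if \<open>u\<^sup>2 = 1\<close>, then \<open>(u + 1)\<^sup>2 = 0\<close>.
\<close>
lemma odd_card_Units:
  assumes "finite (carrier R)" "reduced_ring R" "\<And>x. x \<in> carrier R \<Longrightarrow> x \<oplus> x = \<zero>"
  shows "odd (card (Units R))"
proof -
  note fin = finite_Units[OF assms(1)]
  have "even (card (Units R - {\<one>}))"
  proof (rule even_card_involution[where f = "\<lambda>u. inv u"])
    fix u assume u: "u \<in> Units R - {\<one>}"
    then have uR: "u \<in> carrier R" and ui: "u \<otimes> inv u = \<one>" by auto
    show "inv (inv u) = u" using u by simp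
    then show "inv u \<in> Units R - {\<one>}" using u by (metis DiffD1 DiffD2 DiffI Units_inv_Units inv_one singleton_iff)
    show "inv u \<noteq> u"
    proof
      assume "inv u = u"
      then have "u \<otimes> u = \<one>" using ui by simp
      moreover have "(u \<oplus> \<one>) \<otimes> (u \<oplus> \<one>) = (u \<otimes> u \<oplus> \<one>) \<oplus> (u \<oplus> u)" using uR by algebra
      ultimately have "(u \<oplus> \<one>) \<otimes> (u \<oplus> \<one>) = \<zero>" using uR assms(3) by simp
      then have "u \<oplus> \<one> = \<zero>" by (rule reduced_ringD[OF assms(2) a_closed[OF uR one_closed]])
      also have "\<dots> = \<one> \<oplus> \<one>" using assms(3) by simp
      finally show False using u uR by simp
    qed
  qed (use fin in auto)
  moreover have "card (Units R) = Suc (card (Units R - {\<one>}))"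
    by (rule card.remove[OF fin Units_one_closed])
  ultimately show ?thesis by (simp only: even_Suc not_not)
qed

text \<open>
  Otherwise negation would be an involution of the units without fixed points.
\<close>
lemma two_eq_zero_if_odd_Units:
  assumes "finite (carrier R)" and oddU: "odd (card (Units R))"
  shows "\<one> \<oplus> \<one> = \<zero>"
proof (rule ccontr)
  note finU = finite_Units[OF assms(1)]
  assume two: "\<one> \<oplus> \<one> \<noteq> \<zero>"
  have "even (card (Units R))"
  proof (rule even_card_involution[where f = "\<lambda>u. \<ominus> u", OF finU])
    fix u assume u: "u \<in> Units R"
    have uR: "u \<in> carrier R" using u by (rule Units_closed)
    have vR: "inv u \<in> carrier R" and uv: "u \<otimes> inv u = \<one>" using u by simp_all
    have "(\<ominus> u) \<otimes> (\<ominus> (inv u)) = \<one>" "(\<ominus> (inv u)) \<otimes> (\<ominus> u) = \<one>"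
      using uR vR uv by (simp_all add: l_minus r_minus m_comm)
    then show "\<ominus> u \<in> Units R" using uR vR unfolding Units_def by blast
    show "\<ominus> (\<ominus> u) = u" using uR by simp
    show "\<ominus> u \<noteq> u"
    proof
      assume "\<ominus> u = u"
      then have "u \<oplus> u = \<zero>" using r_neg[OF uR] by simp
      then have "u \<otimes> (\<one> \<oplus> \<one>) = u \<otimes> \<zero>" using uR by (simp add: r_distr)
      then show False using u two by simp
    qed
  qed
  then show False using oddU by simp
qed

text \<open>
  If \<open>x\<^sup>2 = 0\<close> and \<open>x \<noteq> 0\<close>, then multiplication by \<open>1 + x\<close> would be an involution of the units
  without fixed points.
\<close>
lemma reduced_if_odd_Units:
  assumes "finite (carrier R)" and oddU: "odd (card (Units R))"
    and char2: "\<And>x. x \<in> carrier R \<Longrightarrow> x \<oplus> x = \<zero>"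
  shows "reduced_ring R"
proof (rule ccontr)
  note finU = finite_Units[OF assms(1)]
  assume "\<not> reduced_ring R"
  then obtain x where x: "x \<in> carrier R" "x \<otimes> x = \<zero>" "x \<noteq> \<zero>"
    by (auto simp: reduced_ring_def)
  have "(\<one> \<oplus> x) \<otimes> (\<one> \<oplus> x) = \<one> \<oplus> (x \<oplus> x) \<oplus> x \<otimes> x" using x(1) by algebra
  then have sq: "(\<one> \<oplus> x) \<otimes> (\<one> \<oplus> x) = \<one>" using x char2 by simp
  then have unit: "\<one> \<oplus> x \<in> Units R" using x(1) by (auto simp: Units_def)
  have "even (card (Units R))"
  proof (rule even_card_involution[where f = "\<lambda>u. u \<otimes> (\<one> \<oplus> x)", OF finU])
    fix u assume u: "u \<in> Units R"
    have uR: "u \<in> carrier R" using u by (rule Units_closed)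
    show "u \<otimes> (\<one> \<oplus> x) \<in> Units R" using u unit by simp
    show "u \<otimes> (\<one> \<oplus> x) \<otimes> (\<one> \<oplus> x) = u" using uR x(1) sq by (simp add: m_assoc)
    show "u \<otimes> (\<one> \<oplus> x) \<noteq> u"
    proof
      assume "u \<otimes> (\<one> \<oplus> x) = u"
      then have "u \<otimes> (\<one> \<oplus> x) = u \<otimes> \<one>" using uR by simp
      then have "\<one> \<oplus> x = \<one>" using Units_l_cancel[OF u a_closed[OF one_closed x(1)] one_closed] by simp
      then show False using x by simp
    qed
  qed
  then show False using oddU by simp
qed

lemma even_order_if_double_zero:
  assumes "finite (carrier R)" "y \<in> carrier R" "y \<noteq> \<zero>" "y \<oplus> y = \<zero>"
  shows "even (card (carrier R))"
proof (rule even_card_involution[where f = "\<lambda>r. r \<oplus> y"])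
  fix r assume r: "r \<in> carrier R"
  show "r \<oplus> y \<in> carrier R" using r assms by simp
  show "r \<oplus> y \<oplus> y = r" using r assms by (simp add: a_assoc)
  show "r \<oplus> y \<noteq> r" using r assms by simp
qed (rule assms(1))

end

section \<open>The total graph of a finite ring\<close>

lemma pair_graph_total_graph:
  fixes R (structure)
  assumes "cring R" "finite (carrier R)"
  shows "pair_graph (total_graph R)"
proof -
  interpret cring R by fact
  have "finite (parcs (total_graph R))"
    by (rule finite_subset[of _ "carrier R \<times> carrier R"]) (use assms(2) in \<open>auto simp: total_graph_def\<close>)
  moreover have "symmetric (with_proj (total_graph R))"
    by (auto simp: symmetric_def sym_def total_graph_def a_comm)
  ultimately show ?thesis
    using assms(2) by unfold_locales (auto simp: total_graph_def)
qed

context cring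
begin

text \<open>
  Adding \<open>x\<close> maps the neighbours of \<open>x\<close> onto the zero-divisors other than \<open>x + x\<close>, the image of the
  vertex \<open>x\<close> itself.
\<close>
lemma total_graph_degree:
  assumes x: "x \<in> carrier R"
  shows "card {y. (x, y) \<in> parcs (total_graph R)} =
    card (zero_divisors R - {x \<oplus> x})"
proof -
  have Z: "zero_divisors R \<subseteq> carrier R" by (auto simp: zero_divisors_def)
  have "bij_betw (\<lambda>y. x \<oplus> y) {y. (x, y) \<in> parcs (total_graph R)} (zero_divisors R - {x \<oplus> x})"
  proof (rule bij_betw_byWitness[where f' = "\<lambda>z. z \<ominus> x"])
    have *: "x \<oplus> (z \<ominus> x) = z" "x \<oplus> z \<ominus> x = z" if "z \<in> carrier R" for z
      using that x by algebra+
    show "(\<lambda>z. z \<ominus> x) ` (zero_divisors R - {x \<oplus> x}) \<subseteq> {y. (x, y) \<in> parcs (total_graph R)}"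
    proof -
      have "x \<noteq> z \<ominus> x" if "z \<in> carrier R" "z \<noteq> x \<oplus> x" for z
        using *[OF that(1)] that(2) by metis
      then show ?thesis using Z x * by (auto simp: total_graph_def)
    qed
    show "\<forall>a\<in>{y. (x, y) \<in> parcs (total_graph R)}. x \<oplus> a \<ominus> x = a"
      using * by (auto simp: total_graph_def)
    show "\<forall>a'\<in>zero_divisors R - {x \<oplus> x}. x \<oplus> (a' \<ominus> x) = a'"
      using Z * by auto
    show "(\<oplus>) x ` {y. (x, y) \<in> parcs (total_graph R)} \<subseteq> zero_divisors R - {x \<oplus> x}"
    proof (rule image_subsetI)
      fix y assume "y \<in> {y. (x, y) \<in> parcs (total_graph R)}"
      then have y: "y \<in> carrier R" "x \<noteq> y" "x \<oplus> y \<in> zero_divisors R" by (auto simp: total_graph_def)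
      then have "x \<oplus> y \<noteq> x \<oplus> x" using *(2)[OF y(1)] *(2)[OF x] by metis
      then show "x \<oplus> y \<in> zero_divisors R - {x \<oplus> x}" using y(3) by simp
    qed
  qed
  then show ?thesis by (rule bij_betw_same_card)
qed

text \<open>
  In a field the only zero-divisor is \<open>0\<close>, so the vertex \<open>0\<close> has no neighbours.
\<close>
lemma connected_total_graph_imp_not_field:
  assumes "finite (carrier R)" "\<one> \<noteq> \<zero>"
    and conn: "Digraph_Component.connected (total_graph R)"
  shows "\<not> field R"
proof
  interpret T: pair_graph "total_graph R"
    using pair_graph_total_graph[OF is_cring assms(1)] .
  let ?Z = "zero_divisors R"
  note Z = zero_divisors_finite[OF assms(1,2)]
  assume "field R"
  then have Z0: "?Z = {\<zero>}" using Z field.field_Units[of R] by auto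
  have "strongly_connected (total_graph R)"
    using T.symmetric_connected_imp_strongly_connected[OF T.sym_arcs conn] .
  then have "\<zero> \<rightarrow>\<^sup>*\<^bsub>total_graph R\<^esub> \<one>"
    by (auto simp: strongly_connected_def total_graph_def)
  then have "\<one> = \<zero>"
  proof (induction rule: T.reachable_induct)
    case (step x y)
    then have "(\<zero>, y) \<in> parcs (total_graph R)" by simp
    then have "y \<in> ?Z" by (auto simp: total_graph_def)
    then show ?case using Z0 by simp
  qed simp
  then show False using assms(2) by simp
qed

text \<open>
  Every vertex is at distance at most two from \<open>0\<close>. The intermediate vertex comes from writing the
  given vertex as a sum of elements of two distinct maximal ideals.
\<close>
lemma connected_total_graph_if_reduced:
  assumes "finite (carrier R)" "\<one> \<noteq> \<zero>" and "reduced_ring R" "\<not> field R"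
    and R: "\<And>x. x \<in> carrier R \<Longrightarrow> x \<oplus> x = \<zero>"
  shows "Digraph_Component.connected (total_graph R)"
proof -
  interpret T: pair_graph "total_graph R"
    using pair_graph_total_graph[OF is_cring assms(1)] .
  let ?Z = "zero_divisors R"
  note Z = zero_divisors_finite[OF assms(1,2)]
  \<comment> \<open>A non-zero element of one maximal ideal lies outside some other one.\<close>
  obtain M N where MN: "maximalideal M R" "maximalideal N R" "M \<noteq> N"
  proof -
    have "\<zero> \<notin> Units R" using assms(2) by (auto simp: Units_def)
    then obtain M where M: "maximalideal M R"
      using nonunit_in_maximal[OF assms(1) zero_closed] by auto
    have "M \<noteq> {\<zero>}" using M assms(4) zeromaximalideal_fieldI by auto
    moreover have "\<zero> \<in> M"
      using additive_subgroup.zero_closed[OF ideal.axioms(1)[OF maximalideal.axioms(1)[OF M]]] .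
    ultimately obtain a where a: "a \<in> M" "a \<noteq> \<zero>" by auto
    have "a \<in> carrier R" using a(1) ideal_subset[OF maximalideal.axioms(1)[OF M]] by auto
    then obtain N where "maximalideal N R" "a \<notin> N"
      using reduced_Inter_maximal[OF assms(1,3,2)] a(2) by metis
    then show thesis using that M a(1) by metis
  qed
  have sub: "I \<subseteq> ?Z" if "maximalideal I R" for I
  proof
    fix i assume i: "i \<in> I"
    interpret maximalideal I R by fact
    have "i \<notin> Units R"
    proof
      assume u: "i \<in> Units R"
      then have "\<one> \<in> I" using I_r_closed[OF i, of "inv i"] by simp
      then show False using one_imp_carrier I_notcarr by simp
    qed
    then show "i \<in> ?Z" using Z i Icarr by simp
  qed
  \<comment> \<open>The graph has no loops, so the vertices of the path may coincide.\<close>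
  have edge: "(x, y) \<in> parcs (total_graph R) \<or> x = y"
    if "x \<in> carrier R" "y \<in> carrier R" "x \<oplus> y \<in> ?Z" for x y
    using that by (auto simp: total_graph_def)
  have reach: "\<zero> \<rightarrow>\<^sup>*\<^bsub>total_graph R\<^esub> x" if x: "x \<in> carrier R" for x
  proof -
    obtain m n where mn: "m \<in> M" "n \<in> N" "x = m \<oplus> n"
      using x comaximal_of_distinct_maximal[OF MN] unfolding set_add_def' by blast
    have "m \<in> ?Z" "n \<in> ?Z" using mn MN sub by auto
    then have mnZ: "m \<in> ?Z" "n \<in> ?Z" "m \<in> carrier R" "n \<in> carrier R" using Z by auto
    have "m \<oplus> x = (m \<oplus> m) \<oplus> n" unfolding mn(3) using mnZ by (simp add: a_assoc)
    then have "m \<oplus> x = n" using R mnZ by simp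
    then have "(m, x) \<in> parcs (total_graph R) \<or> m = x" using edge mnZ x by simp
    moreover have "(\<zero>, m) \<in> parcs (total_graph R) \<or> \<zero> = m" using edge mnZ by simp
    ultimately show ?thesis
      using x T.reachable_adjI T.reachable_trans T.reachable_refl
      by (metis (no_types, lifting) pair_pre_digraph.select_convs(1) total_graph_def)
  qed
  have "strongly_connected (total_graph R)"
  proof (rule strongly_connectedI)
    show "verts (with_proj (total_graph R)) \<noteq> {}" by (auto simp: total_graph_def)
    fix u v assume "u \<in> verts (with_proj (total_graph R))" "v \<in> verts (with_proj (total_graph R))"
    then have "\<zero> \<rightarrow>\<^sup>*\<^bsub>total_graph R\<^esub> u" "\<zero> \<rightarrow>\<^sup>*\<^bsub>total_graph R\<^esub> v"
      using reach by (auto simp: total_graph_def)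
    then show "u \<rightarrow>\<^sup>*\<^bsub>total_graph R\<^esub> v"
      using T.symmetric_reachable' T.reachable_trans by blast
  qed
  then show ?thesis
    by (auto simp: connected_def strongly_connected_def T.reachable_mk_symmetric_eq[OF T.sym_arcs])
qed

lemma eulerian_total_graph_iff:
  assumes "finite (carrier R)" "\<one> \<noteq> \<zero>"
  shows "eulerian (total_graph R) \<longleftrightarrow>
    (\<forall>x\<in>carrier R. x \<oplus> x = \<zero>) \<and> reduced_ring R \<and> \<not> field R"
proof -
  interpret T: pair_graph "total_graph R"
    using pair_graph_total_graph[OF is_cring assms(1)] .
  let ?Z = "zero_divisors R"
  have finZ: "finite ?Z" using zero_divisors_finite[OF assms] assms(1) by simp
  have ZZ: "\<zero> \<in> ?Z" by (simp add: zero_divisors_def)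
  note cardZ = card.remove[OF finZ ZZ]
  note card = card_carrier_eq[OF assms]
  show ?thesis
  proof
    assume eu: "eulerian (total_graph R)"
    have deg: "even (card (?Z - {x \<oplus> x}))" if "x \<in> carrier R" for x
      using T.eulerian_imp_even_degree[OF eu, of x] total_graph_degree[OF that] by simp
    have oddZ: "odd (card ?Z)" using deg[of \<zero>] cardZ by simp
    \<comment> \<open>Otherwise the vertex \<open>1\<close> would have the odd degree \<open>card ?Z\<close>.\<close>
    have "\<one> \<oplus> \<one> \<in> ?Z"
    proof (rule ccontr)
      assume "\<not> ?thesis"
      then show False using deg[of \<one>] oddZ by simp
    qed
    then obtain y where y: "y \<in> carrier R" "y \<noteq> \<zero>" "(\<one> \<oplus> \<one>) \<otimes> y = \<zero>"
      using zero_divisors_iff[OF assms(2)] by blast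
    have "(\<one> \<oplus> \<one>) \<otimes> y = y \<oplus> y" using y(1) by algebra
    then have "even (card (carrier R))"
      using even_order_if_double_zero[OF assms(1) y(1,2)] y(3) by simp
    then have oddU: "odd (card (Units R))" using oddZ card by simp
    have char2: "x \<oplus> x = \<zero>" if x: "x \<in> carrier R" for x
    proof -
      have "x \<oplus> x = (\<one> \<oplus> \<one>) \<otimes> x" using x by algebra
      then show ?thesis using two_eq_zero_if_odd_Units[OF assms(1) oddU] x by simp
    qed
    moreover have "reduced_ring R" using reduced_if_odd_Units[OF assms(1) oddU char2] .
    moreover have "\<not> field R"
      using connected_total_graph_imp_not_field[OF assms] eu by (simp add: eulerian_def)
    ultimately show "(\<forall>x\<in>carrier R. x \<oplus> x = \<zero>) \<and> reduced_ring R \<and> \<not> field R" by blast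
  next
    assume R: "(\<forall>x\<in>carrier R. x \<oplus> x = \<zero>) \<and> reduced_ring R \<and> \<not> field R"
    have "even (card (carrier R))"
      using even_order_if_double_zero[OF assms(1) one_closed assms(2)] R by simp
    moreover have "odd (card (Units R))" using odd_card_Units[OF assms(1)] R by blast
    ultimately have "odd (card ?Z)" using card by simp
    then have ev: "even (card (?Z - {\<zero>}))" unfolding cardZ by simp
    show "eulerian (total_graph R)"
    proof (rule T.eulerianI_even_degree)
      fix v assume "v \<in> pverts (total_graph R)"
      then have v: "v \<in> carrier R" by (simp add: total_graph_def)
      then show "even (card {y. (v, y) \<in> parcs (total_graph R)})"
        using ev R total_graph_degree[OF v] by simp
    next
      show "Digraph_Component.connected (total_graph R)"
        using connected_total_graph_if_reduced[OF assms] R by blast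
    qed
  qed
qed

end

section \<open>Products of fields of even order\<close>

lemma RDirProd_list_cong:
  fixes Rs :: "('a, 'm) ring_scheme list" and Ss :: "('b, 'n) ring_scheme list"
  assumes "list_all2 (\<simeq>) Rs Ss"
  shows "RDirProd_list Rs \<simeq> RDirProd_list Ss"
  using assms
proof (induction rule: list_all2_induct)
  case Nil
  have "(\<lambda>_. []) \<in> ring_iso (nil_ring :: 'a list ring) (nil_ring :: 'b list ring)"
    by (auto simp: ring_iso_def ring_hom_def bij_betw_def monoid.defs)
  then show ?case unfolding is_ring_iso_def by auto
next
  case (Cons R Rs S Ss)
  then obtain f g where fg: "f \<in> ring_iso R S"
      "g \<in> ring_iso (RDirProd_list Rs) (RDirProd_list Ss)"
    unfolding is_ring_iso_def by blast
  from ring_iso_set_trans[OF ring_iso_set_trans[OF RDirProd_list_iso2 RDirProd_iso6[OF fg]] RDirProd_list_iso1]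
  show ?case unfolding is_ring_iso_def by blast
qed

lemma RDirProd_list_Cons_simps:
  assumes "x \<in> carrier R" "y \<in> carrier R" "xs \<in> carrier (RDirProd_list Rs)"
    "ys \<in> carrier (RDirProd_list Rs)"
  shows "(x # xs) \<oplus>\<^bsub>RDirProd_list (R # Rs)\<^esub> (y # ys) = (x \<oplus>\<^bsub>R\<^esub> y) # (xs \<oplus>\<^bsub>RDirProd_list Rs\<^esub> ys)"
    "(x # xs) \<otimes>\<^bsub>RDirProd_list (R # Rs)\<^esub> (y # ys) = (x \<otimes>\<^bsub>R\<^esub> y) # (xs \<otimes>\<^bsub>RDirProd_list Rs\<^esub> ys)"
  using ring_hom_add[OF RDirProd_list_hom1[of R Rs], of "(x, xs)" "(y, ys)"]
    ring_hom_mult[OF RDirProd_list_hom1[of R Rs], of "(x, xs)" "(y, ys)"] assms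
  by (simp_all add: RDirProd_carrier) (simp_all add: RDirProd_def DirProd_def monoid.defs)

lemma RDirProd_list_one_Cons: "\<one>\<^bsub>RDirProd_list (R # Rs)\<^esub> = \<one>\<^bsub>R\<^esub> # \<one>\<^bsub>RDirProd_list Rs\<^esub>"
  by (simp add: RDirProd_list_one)

lemma RDirProd_list_double:
  assumes "\<And>R x. R \<in> set Rs \<Longrightarrow> x \<in> carrier R \<Longrightarrow> x \<oplus>\<^bsub>R\<^esub> x = \<zero>\<^bsub>R\<^esub>"
  shows "xs \<in> carrier (RDirProd_list Rs) \<Longrightarrow> xs \<oplus>\<^bsub>RDirProd_list Rs\<^esub> xs = \<zero>\<^bsub>RDirProd_list Rs\<^esub>"
  using assms
proof (induction Rs arbitrary: xs)
  case Nil
  then show ?case by (simp add: monoid.defs)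
next
  case (Cons R Rs)
  then show ?case
    by (auto simp: RDirProd_list_carrier RDirProd_list_Cons_simps RDirProd_list_zero')
qed

lemma reduced_RDirProd_list:
  assumes "\<And>R. R \<in> set Rs \<Longrightarrow> reduced_ring R"
  shows "reduced_ring (RDirProd_list Rs)"
  using assms
proof (induction Rs)
  case Nil
  then show ?case by (simp add: reduced_ring_def monoid.defs)
next
  case (Cons R Rs)
  then have "reduced_ring R" "reduced_ring (RDirProd_list Rs)" by auto
  then show ?case unfolding reduced_ring_def
    by (auto simp: RDirProd_list_carrier RDirProd_list_Cons_simps RDirProd_list_zero')
qed

text \<open>
  The elements \<open>(1, 0)\<close> and \<open>(0, 1)\<close> of the product of the first factor with the product of the
  others are non-zero and multiply to zero.
\<close>
lemma RDirProd_list_not_domain: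
  assumes "ring R" "ring S" "\<one>\<^bsub>R\<^esub> \<noteq> \<zero>\<^bsub>R\<^esub>" "\<one>\<^bsub>S\<^esub> \<noteq> \<zero>\<^bsub>S\<^esub>" "ring (RDirProd_list Rs)"
  shows "\<not> domain (RDirProd_list (R # S # Rs))"
proof
  let ?P = "RDirProd_list (S # Rs)"
  let ?e = "\<one>\<^bsub>R\<^esub> # \<zero>\<^bsub>?P\<^esub>" and ?f = "\<zero>\<^bsub>R\<^esub> # \<one>\<^bsub>?P\<^esub>"
  assume dom: "domain (RDirProd_list (R # S # Rs))"
  have P: "ring ?P"
    using ring.inj_imp_image_ring_is_ring[OF RDirProd_ring[OF assms(2,5)] inj_on_RDirProd_carrier]
    unfolding RDirProd_list_def by simp
  interpret R: ring R by fact
  interpret P: ring ?P by fact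
  have "?e \<otimes>\<^bsub>RDirProd_list (R # S # Rs)\<^esub> ?f = \<zero>\<^bsub>RDirProd_list (R # S # Rs)\<^esub>"
    by (simp add: RDirProd_list_Cons_simps RDirProd_list_zero'[of R])
  moreover have "?e \<in> carrier (RDirProd_list (R # S # Rs))" "?f \<in> carrier (RDirProd_list (R # S # Rs))"
    by (auto simp: RDirProd_list_carrier[of R])
  ultimately have "?e = \<zero>\<^bsub>RDirProd_list (R # S # Rs)\<^esub> \<or> ?f = \<zero>\<^bsub>RDirProd_list (R # S # Rs)\<^esub>"
    using domain.integral[OF dom] by blast
  then show False using assms(3,4) by (auto simp: RDirProd_list_zero' RDirProd_list_one_Cons)
qed

lemma ring_iso_transfer:
  assumes "ring R" "ring S" "R \<simeq> S"
  shows "(\<forall>x\<in>carrier S. x \<oplus>\<^bsub>S\<^esub> x = \<zero>\<^bsub>S\<^esub>) \<Longrightarrow> \<forall>x\<in>carrier R. x \<oplus>\<^bsub>R\<^esub> x = \<zero>\<^bsub>R\<^esub>"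
    and "reduced_ring S \<Longrightarrow> reduced_ring R"
    and "field R \<Longrightarrow> domain S"
proof -
  interpret R: ring R by fact
  interpret S: ring S by fact
  obtain h where h: "h \<in> ring_iso R S" using assms(3) unfolding is_ring_iso_def by auto
  then have hom: "h \<in> ring_hom R S" and bij: "bij_betw h (carrier R) (carrier S)"
    by (auto simp: ring_iso_def)
  have z: "h \<zero>\<^bsub>R\<^esub> = \<zero>\<^bsub>S\<^esub>" using ring_hom_zero[OF hom assms(1,2)] .
  have eq: "x = y" if "h x = h y" "x \<in> carrier R" "y \<in> carrier R" for x y
    using bij that by (auto simp: bij_betw_def inj_on_def)
  have mem: "h x \<in> carrier S" if "x \<in> carrier R" for x using ring_hom_closed[OF hom that] .
  show "\<forall>x\<in>carrier R. x \<oplus>\<^bsub>R\<^esub> x = \<zero>\<^bsub>R\<^esub>" if "\<forall>x\<in>carrier S. x \<oplus>\<^bsub>S\<^esub> x = \<zero>\<^bsub>S\<^esub>"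
    using that eq z mem ring_hom_add[OF hom] by (metis R.add.m_closed R.zero_closed)
  show "reduced_ring R" if S: "reduced_ring S"
    unfolding reduced_ring_def
  proof (intro ballI impI)
    fix x assume x: "x \<in> carrier R" "x \<otimes>\<^bsub>R\<^esub> x = \<zero>\<^bsub>R\<^esub>"
    then have "h x \<otimes>\<^bsub>S\<^esub> h x = \<zero>\<^bsub>S\<^esub>" using ring_hom_mult[OF hom x(1) x(1)] z by simp
    then have "h x = \<zero>\<^bsub>S\<^esub>" by (rule reduced_ringD[OF S mem[OF x(1)]])
    then show "x = \<zero>\<^bsub>R\<^esub>" using eq z x(1) by simp
  qed
  show "domain S" if "field R"
  proof -
    interpret field R by fact
    have "domain (S\<lparr>zero := h \<zero>\<^bsub>R\<^esub>\<rparr>)" using ring_iso_imp_img_domain[OF h] .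
    then show ?thesis using z by simp
  qed
qed

lemma finite_field_of_order_two_power:
  assumes "field F" "finite (carrier F)" "\<And>x. x \<in> carrier F \<Longrightarrow> x \<oplus>\<^bsub>F\<^esub> x = \<zero>\<^bsub>F\<^esub>"
  shows "\<exists>t>0. finite_field_of_order (2 ^ t) F"
proof -
  interpret field F by fact
  obtain t where t: "order (add_monoid F) = 2 ^ t"
    using order_two_power_if_involutive[OF a_group] assms(2,3) by auto
  then have o: "order F = 2 ^ t" by (simp add: order_def)
  have "{\<zero>\<^bsub>F\<^esub>, \<one>\<^bsub>F\<^esub>} \<subseteq> carrier F" by simp
  then have "2 \<le> order F" using card_mono[OF assms(2), of "{\<zero>\<^bsub>F\<^esub>, \<one>\<^bsub>F\<^esub>}"] by (simp add: order_def)
  then have "t > 0" using o by (cases t) auto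
  then show ?thesis using o assms unfolding finite_field_of_order_def by blast
qed

text \<open>
  The residue fields of \<open>R\<close> consist of cosets. A finite field can be renumbered, which provides
  factors whose elements are natural numbers.
\<close>
lemma finite_field_of_order_nat_copy:
  assumes "finite_field_of_order q F"
  shows "\<exists>F' :: nat ring. F \<simeq> F' \<and> finite_field_of_order q F'"
proof -
  interpret field F using assms by (simp add: finite_field_of_order_def)
  have "finite (carrier F)" using assms by (simp add: finite_field_of_order_def)
  then obtain f :: "'a \<Rightarrow> nat" where f: "inj_on f (carrier F)"
    using finite_imp_inj_to_nat_seg by blast
  let ?F' = "image_ring f F"
  have "f \<in> ring_iso F ?F'" using inj_imp_image_ring_iso[OF f] .
  then have "F \<simeq> ?F'" unfolding is_ring_iso_def by blast
  moreover have "field ?F'" using inj_imp_image_ring_is_field[OF f] .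
  moreover have "order ?F' = order F" using f by (simp add: order_def image_ring_carrier card_image)
  ultimately show ?thesis
    using assms by (auto simp: finite_field_of_order_def image_ring_carrier)
qed

text \<open>
  From left to right the first two properties hold in each factor and hence in the product. From right
  to left the factors are the residue fields at the maximal ideals.
\<close>
lemma iso_product_of_even_fields_iff:
  fixes R :: "('a, 'm) ring_scheme" (structure)
  assumes "cring R" "finite (carrier R)" "\<one> \<noteq> \<zero>"
  shows "(\<exists>(k::nat) (t :: nat \<Rightarrow> nat) (F :: nat \<Rightarrow> nat ring).
        k \<ge> 2 \<and> (\<forall>i<k. t i > 0 \<and> finite_field_of_order (2 ^ t i) (F i)) \<and>
        R \<simeq> RDirProd_list (map F [0..<k])) \<longleftrightarrow>
    (\<forall>x\<in>carrier R. x \<oplus> x = \<zero>) \<and> reduced_ring R \<and> \<not> field R" (is "?lhs \<longleftrightarrow> ?rhs")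
proof
  interpret cring R by fact
  assume ?lhs
  then obtain k and t :: "nat \<Rightarrow> nat" and F :: "nat \<Rightarrow> nat ring" where k: "k \<ge> 2"
    and F: "\<And>i. i < k \<Longrightarrow> t i > 0 \<and> finite_field_of_order (2 ^ t i) (F i)"
    and iso: "R \<simeq> RDirProd_list (map F [0..<k])" by blast
  have field: "field (F i)" if "i < k" for i using F[OF that] by (simp add: finite_field_of_order_def)
  have ring: "ring (F i)" if "i < k" for i
    using field[OF that] by (simp add: field.is_ring)
  have rings: "ring (RDirProd_list (map F [0..<k]))" "ring (RDirProd_list (map F [2..<k]))"
    using ring by (auto intro!: RDirProd_list_is_ring)
  note transfer = ring_iso_transfer[OF ring_axioms rings(1) iso]
  have "\<forall>x\<in>carrier R. x \<oplus> x = \<zero>"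
  proof (rule transfer(1), rule ballI, rule RDirProd_list_double)
    fix S x assume "S \<in> set (map F [0..<k])" and x: "x \<in> carrier S"
    then obtain i where i: "i < k" "S = F i" by auto
    then have "even (order S)" "finite (carrier S)" using F[OF i(1)] by (auto simp: finite_field_of_order_def)
    then show "x \<oplus>\<^bsub>S\<^esub> x = \<zero>\<^bsub>S\<^esub>" using double_zero_if_even_order[of S x] field i x by simp
  qed
  moreover have "reduced_ring R"
  proof (rule transfer(2), rule reduced_RDirProd_list)
    fix S assume "S \<in> set (map F [0..<k])"
    then obtain i where "i < k" "S = F i" by auto
    then show "reduced_ring S" using reduced_if_domain[OF field.axioms(1)[OF field]] by simp
  qed
  moreover have "\<not> domain (RDirProd_list (map F [0..<k]))"
  proof -
    have "[0..<k] = 0 # 1 # [2..<k]" using k by (simp add: upt_conv_Cons numeral_2_eq_2)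
    moreover have "\<one>\<^bsub>F i\<^esub> \<noteq> \<zero>\<^bsub>F i\<^esub>" if "i < k" for i
      using domain.one_not_zero[OF field.axioms(1)[OF field[OF that]]] .
    ultimately show ?thesis
      using RDirProd_list_not_domain[OF ring ring _ _ rings(2), of 0 1] k by simp
  qed
  ultimately show ?rhs using transfer(3) by blast
next
  interpret cring R by fact
  assume R: ?rhs
  obtain I n where max: "\<And>i. i \<le> (n::nat) \<Longrightarrow> maximalideal (I i) R"
    and iso: "R \<simeq> RDirProd_list (map (\<lambda>i. R Quot (I i)) [0..<Suc n])" and "n = 0 \<Longrightarrow> field R"
    using reduced_iso_residue_fields[OF assms(2) _ assms(3)] R by metis
  then have n: "n \<noteq> 0" using R by auto
  have "\<exists>t (F :: nat ring). t > 0 \<and> finite_field_of_order (2 ^ t) F \<and> R Quot (I i) \<simeq> F"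
    if i: "i \<le> n" for i
  proof -
    interpret maximalideal "I i" R using max[OF i] .
    have carr: "carrier (R Quot I i) = (\<lambda>a. I i +> a) ` carrier R"
      by (auto simp: FactRing_def A_RCOSETS_def')
    have "x \<oplus>\<^bsub>R Quot I i\<^esub> x = \<zero>\<^bsub>R Quot I i\<^esub>" if x: "x \<in> carrier (R Quot I i)" for x
    proof -
      obtain a where a: "a \<in> carrier R" "x = I i +> a" using x carr by auto
      have "x \<oplus>\<^bsub>R Quot I i\<^esub> x = I i +> (a \<oplus> a)"
        unfolding a(2) by (rule ring_hom_add[OF rcos_ring_hom a(1) a(1), symmetric])
      also have "a \<oplus> a = \<zero>" using R a(1) by blast
      also have "I i +> \<zero> = \<zero>\<^bsub>R Quot I i\<^esub>"
        by (rule ring_hom_zero[OF rcos_ring_hom ring_axioms quotient_is_ring])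
      finally show ?thesis .
    qed
    moreover have "field (R Quot I i)" by (rule quotient_is_field[OF is_cring])
    moreover have "finite (carrier (R Quot I i))" using carr assms(2) by simp
    ultimately obtain t where t: "t > 0" "finite_field_of_order (2 ^ t) (R Quot I i)"
      using finite_field_of_order_two_power by blast
    then show ?thesis using finite_field_of_order_nat_copy by blast
  qed
  then obtain t and F :: "nat \<Rightarrow> nat ring"
    where tF: "\<And>i. i \<le> n \<Longrightarrow> t i > 0 \<and> finite_field_of_order (2 ^ t i) (F i) \<and> R Quot (I i) \<simeq> F i"
    by metis
  \<comment> \<open>The last index is \<open>n\<close>, so there are \<open>n + 1 \<ge> 2\<close> factors, because \<open>R\<close> is not a field.\<close>
  have "list_all2 (\<simeq>) (map (\<lambda>i. R Quot (I i)) [0..<Suc n]) (map F [0..<Suc n])"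
    unfolding list.rel_map by (rule list.rel_refl_strong) (use tF in auto)
  then have "R \<simeq> RDirProd_list (map F [0..<Suc n])"
    using iso RDirProd_list_cong ring_iso_trans by blast
  then show ?lhs using n tF by (intro exI[of _ "Suc n"] exI[of _ t] exI[of _ F]) auto
qed

theorem theorem3p3:
  fixes R :: "('a, 'm) ring_scheme"
  assumes "cring R"
    and "finite (carrier R)"
    and "\<one>\<^bsub>R\<^esub> \<noteq> \<zero>\<^bsub>R\<^esub>"
  shows "eulerian (total_graph R) \<longleftrightarrow>
    (\<exists>(k::nat) (t :: nat \<Rightarrow> nat) (F :: nat \<Rightarrow> nat ring).
        k \<ge> 2 \<and>
        (\<forall>i<k. t i > 0 \<and> finite_field_of_order (2 ^ t i) (F i)) \<and>
        R \<simeq> RDirProd_list (map F [0..<k]))"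
  unfolding iso_product_of_even_fields_iff[OF assms]
  by (rule cring.eulerian_total_graph_iff[OF assms])

end
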